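(* Let $n\ge4$, let $T$ be a 2-tree on $[n-1]$, and let $s=(s_{ij})_{ij\in T}$ be general complex numbers. For every edge $lm$ of $T$, the value of the Plücker coordinate $p_{lm}$ at the unique critical point of $L_T=\sum_{ij\in T}s_{ij}\log(p_{ij})$ equals $$\hat p_{lm}=\pm\prod\frac{[s_{ik}]}{[s_{ik}]+[s_{jk}]},$$ where the product runs over all ancestral triangles $\{i,j,k\}$ of the edge $lm$, labeled such that $ij$ is the parent edge of $ik$ and $jk$, and $lm$ is a descendant of $ik$.
   Context: Coordinates. Put $y_1=0$, $y_2=1$, $y_j=x_{j-2}$ for $3\le j\le n-1$, where $x_1,\dots,x_{n-3}$ are complex coordinates, and $p_{ij}=y_j-y_i$ for $1\le i<j\le n-1$. So $p_{12}=1$. 2-trees. A 2-tree $T$ on $[n-1]=\{1,\dots,n-1\}$ is a graph constructed as follows: start with the single edge $12$; for $k=3,4,\dots,n-1$ successively, select an edge $ij$ of the current graph (with $i,j\in\{1,\dots,k-1\}$) and add the new edges $ik$ and $jk$. In the sum defining $L_T$, $T$ is identified with the set of its $2n-6$ edges different from $12$. Critical points. $L_T$ is considered on the set of $x\in\mathbb{C}^{n-3}$ with $p_{ij}\neq0$ for all $ij\in T$; critical points are points where all $\partial L_T/\partial x_a$ vanish. For general $s$ (outside a proper Zariski closed subset) there is exactly one. Descendants. When the vertex $k$ is attached to the edge $ij$, the new edges $ik$ and $jk$ are called children of $ij$, and $\{i,j,k\}$ is called a triangle of $T$. An edge is a descendant of another edge if it is related to it by the reflexive and transitive closure of this parent-child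 relation (so every edge is a descendant of itself). For an edge $ij\neq12$ of $T$, $[s_{ij}]$ denotes the sum of all $s_{lm}$ where $lm$ is a descendant of $ij$. A triangle $\{i,j,k\}$ arising from attaching $k$ to $ij$ is an ancestral triangle of the edge $lm$ if $lm$ is a descendant of one of the two child edges $ik$, $jk$; the endpoints of the parent edge are labeled so that this child edge is $ik$. Products over the empty set are $1$. We write $s_{ij}=s_{ji}$. *)

theory Defs
  imports "HOL-Complex_Analysis.Complex_Analysis" "HOL-Library.FuncSet"
begin

text \<open>
  Edges are two-element sets of vertices. The third argument of \<open>two_tree\<close> records the
  construction: it contains the pair \<open>({i, j}, k)\<close> iff the vertex \<open>k\<close> was attached to the
  edge \<open>{i, j}\<close>. The edge \<open>{1, 2}\<close> belongs to the second argument; it is removed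
  explicitly where only the other edges are meant.
\<close>

inductive two_tree :: "nat \<Rightarrow> nat set set \<Rightarrow> (nat set \<times> nat) set \<Rightarrow> bool" where
  base: "two_tree 2 {{1, 2}} {}"
| attach: "\<lbrakk>two_tree m T A; {i, j} \<in> T; i \<noteq> j\<rbrakk> \<Longrightarrow>
    two_tree (Suc m) (T \<union> {{i, Suc m}, {j, Suc m}}) (insert ({i, j}, Suc m) A)"

definition child :: "(nat set \<times> nat) set \<Rightarrow> nat set \<Rightarrow> nat set \<Rightarrow> bool" where
  "child A e f \<longleftrightarrow> (\<exists>i j k. ({i, j}, k) \<in> A \<and> e = {i, j} \<and> f = {i, k})"

definition descendant :: "(nat set \<times> nat) set \<Rightarrow> nat set \<Rightarrow> nat set \<Rightarrow> bool" where
  "descendant A e f \<longleftrightarrow> (child A)\<^sup>*\<^sup>* e f"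

definition bracket :: "(nat set \<times> nat) set \<Rightarrow> (nat set \<Rightarrow> complex) \<Rightarrow> nat set \<Rightarrow> complex" where
  "bracket A s e = (\<Sum>f | descendant A e f. s f)"

text \<open>
  Ancestral triangles of \<open>e\<close> as labelled triples: every edge has at most one parent, so \<open>e\<close>
  descends from at most one of the two children \<open>{i, k}\<close>, \<open>{j, k}\<close>, and each ancestral
  triangle occurs with exactly one labelling.
\<close>

definition ancestral_triangles :: "(nat set \<times> nat) set \<Rightarrow> nat set \<Rightarrow> (nat \<times> nat \<times> nat) set" where
  "ancestral_triangles A e = {(i, j, k). ({i, j}, k) \<in> A \<and> descendant A {i, k} e}"

definition ycoord :: "(nat \<Rightarrow> complex) \<Rightarrow> nat \<Rightarrow> complex" where
  "ycoord x j = (if j = 1 then 0 else if j = 2 then 1 else x (j - 2))"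

definition plucker :: "nat set \<Rightarrow> (nat \<Rightarrow> complex) \<Rightarrow> complex" where
  "plucker e x = ycoord x (Max e) - ycoord x (Min e)"

definition log_branch_at :: "complex \<Rightarrow> (complex \<Rightarrow> complex) \<Rightarrow> bool" where
  "log_branch_at w lg \<longleftrightarrow>
     (\<exists>U. open U \<and> w \<in> U \<and> lg holomorphic_on U \<and> (\<forall>z\<in>U. exp (lg z) = z))"

definition potential ::
  "nat set set \<Rightarrow> (nat set \<Rightarrow> complex) \<Rightarrow> (nat set \<Rightarrow> complex \<Rightarrow> complex) \<Rightarrow> (nat \<Rightarrow> complex) \<Rightarrow> complex"
  where "potential T s lg x = (\<Sum>e\<in>T - {{1, 2}}. s e * lg e (plucker e x))"

text \<open>
  The potential is multivalued. Its partial derivatives at a point are computed with local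
  branches of the logarithm, one for each edge; by the two lemmas after the definition, branches
  exist exactly at nonzero points and the choice does not affect the derivatives.
  A point of \<open>\<complex>\<^bsup>n-3\<^esup>\<close> is an extensional function on \<open>{1..n-3}\<close>, so that uniqueness is meaningful.
\<close>

definition critical_point ::
  "nat \<Rightarrow> nat set set \<Rightarrow> (nat set \<Rightarrow> complex) \<Rightarrow> (nat \<Rightarrow> complex) \<Rightarrow> bool" where
  "critical_point n T s x \<longleftrightarrow>
     x \<in> {1..n-3} \<rightarrow>\<^sub>E UNIV \<and>
     (\<forall>e\<in>T. plucker e x \<noteq> 0) \<and>
     (\<exists>lg. (\<forall>e\<in>T. log_branch_at (plucker e x) (lg e)) \<and>
       (\<forall>a\<in>{1..n-3}.
          ((\<lambda>t. potential T s lg (x(a := t))) has_field_derivative 0) (at (x a))))"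

lemma log_branch_at_exists_iff: "(\<exists>lg. log_branch_at w lg) \<longleftrightarrow> w \<noteq> 0"
proof
  show "w \<noteq> 0" if "\<exists>lg. log_branch_at w lg"
    using that unfolding log_branch_at_def by (metis exp_not_eq_zero)
next
  assume w: "w \<noteq> 0"
  have "0 \<notin> ball w (norm w)" by simp
  then obtain lg where "lg holomorphic_on ball w (norm w)" "\<And>z. z \<in> ball w (norm w) \<Longrightarrow> z = exp (lg z)"
    using contractible_imp_holomorphic_log[of "\<lambda>z. z" "ball w (norm w)"]
    by (metis convex_ball convex_imp_contractible holomorphic_on_ident)
  then show "\<exists>lg. log_branch_at w lg"
    unfolding log_branch_at_def using w by (metis centre_in_ball open_ball zero_less_norm_iff)
qed

lemma log_branch_at_deriv:
  assumes "log_branch_at w lg"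
  shows "(lg has_field_derivative 1 / w) (at w)"
proof -
  obtain U where U: "open U" "w \<in> U" "lg holomorphic_on U" "\<forall>z\<in>U. exp (lg z) = z"
    using assms unfolding log_branch_at_def by blast
  obtain d where d: "(lg has_field_derivative d) (at w)"
    using U by (meson holomorphic_on_open)
  have "((\<lambda>z. exp (lg z)) has_field_derivative exp (lg w) * d) (at w)"
    using d by (rule DERIV_chain2[OF DERIV_exp])
  moreover have "((\<lambda>z. exp (lg z)) has_field_derivative 1) (at w)"
    by (rule has_field_derivative_transform_within_open[OF DERIV_ident U(1,2)]) (use U in auto)
  ultimately have "exp (lg w) * d = 1"
    by (rule DERIV_unique)
  with U d show ?thesis
    by (metis exp_not_eq_zero nonzero_eq_divide_eq mult.commute)
qed

text \<open>
  Affine space over \<open>I\<close> consists of the extensional functions \<open>I \<rightarrow>\<^sub>E UNIV\<close>. For finite \<open>I\<close>,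
  polynomial functions on it correspond to polynomials, as the field is infinite.
\<close>

inductive_set polynomial_functions :: "'i set \<Rightarrow> (('i \<Rightarrow> complex) \<Rightarrow> complex) set" for I :: "'i set"
where
  const: "(\<lambda>_. c) \<in> polynomial_functions I"
| coord: "i \<in> I \<Longrightarrow> (\<lambda>s. s i) \<in> polynomial_functions I"
| add: "\<lbrakk>f \<in> polynomial_functions I; g \<in> polynomial_functions I\<rbrakk> \<Longrightarrow>
    (\<lambda>s. f s + g s) \<in> polynomial_functions I"
| mult: "\<lbrakk>f \<in> polynomial_functions I; g \<in> polynomial_functions I\<rbrakk> \<Longrightarrow>
    (\<lambda>s. f s * g s) \<in> polynomial_functions I"

definition zariski_closed :: "'i set \<Rightarrow> ('i \<Rightarrow> complex) set \<Rightarrow> bool" where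
  "zariski_closed I Z \<longleftrightarrow>
     (\<exists>F \<subseteq> polynomial_functions I. Z = {s \<in> I \<rightarrow>\<^sub>E UNIV. \<forall>f\<in>F. f s = 0})"

end

theory Submission
  imports Defs
begin

text \<open>
  Write \<open>y\<close> for the coordinates of the vertices. The critical equation at a vertex \<open>v\<close> says that
  the sum of \<open>s\<^bsub>uv\<^esub> / (y\<^sub>v - y\<^sub>u)\<close> over the edges \<open>uv\<close> at \<open>v\<close> vanishes. The vertex \<open>k\<close> attached
  last, to an edge \<open>ij\<close>, lies on two edges only, so its equation
  \<open>s\<^bsub>ik\<^esub> / (y\<^sub>k - y\<^sub>i) + s\<^bsub>jk\<^esub> / (y\<^sub>k - y\<^sub>j) = 0\<close> puts \<open>y\<^sub>k\<close> at a weighted mean of \<open>y\<^sub>i\<close> and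
  \<open>y\<^sub>j\<close>:
  \<open>(y\<^sub>k - y\<^sub>i) (s\<^bsub>ik\<^esub> + s\<^bsub>jk\<^esub>) = s\<^bsub>ik\<^esub> (y\<^sub>j - y\<^sub>i)\<close>.
  Once this holds, the two edges \<open>ik\<close> and \<open>jk\<close> contribute to the equations at \<open>i\<close> and \<open>j\<close>
  exactly what an extra weight \<open>s\<^bsub>ik\<^esub> + s\<^bsub>jk\<^esub>\<close> on the parent edge \<open>ij\<close> would contribute. Hence
  \<open>k\<close> can be removed if its two weights are added to that of \<open>ij\<close>
  (\<open>critical_configuration_attach\<close>). Repeating this collects on every edge the weights of all its
  descendants, and this total is the bracket (\<open>bracket_old\<close>). So a critical point is the same as
  a solution of one linear relation for each triangle, with brackets as coefficients
  (\<open>critical_iff_triangle_relations\<close>).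

  The relation of a triangle determines the new vertex from the two older ones as soon as the
  brackets of its two child edges do not cancel. This gives existence and uniqueness. It also gives
  the product formula, since the relation expresses the difference along a child edge as the
  difference along its parent edge times a quotient of brackets, up to the sign that comes from
  ordering the endpoints. Following the ancestors of an edge up to \<open>{1, 2}\<close>, where the difference is
  \<open>1\<close>, multiplies these quotients (\<open>signed_product_formula_exists\<close>).

  The argument requires the brackets of child edges and the sums of two sibling brackets to be
  nonzero. The excluded set \<open>Z\<close> is the zero locus of the product of all of these, and \<open>Z\<close> is proper because
  at \<open>s = 1\<close> each of these brackets counts descendants and is a positive integer.
\<close>

section \<open>The combinatorics of attaching a vertex\<close>

lemma two_tree_ge_2: "two_tree m T A \<Longrightarrow> 2 \<le> m"
  by (induction rule: two_tree.induct) auto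

lemma two_tree_edge:
  assumes "two_tree m T A" and "e \<in> T"
  obtains i j where "e = {i, j}" "i < j" "i \<in> {1..m}" "j \<in> {1..m}"
proof -
  have "\<exists>i j. e = {i, j} \<and> i < j \<and> i \<in> {1..m} \<and> j \<in> {1..m}"
    using assms
  proof (induction arbitrary: e rule: two_tree.induct)
    case base
    then show ?case by (intro exI[of _ 1] exI[of _ 2]) auto
  next
    case (attach m T A i j)
    obtain a b where ab: "{i, j} = {a, b}" "a \<in> {1..m}" "b \<in> {1..m}"
      using attach.IH[OF attach.hyps(2)] by blast
    then have "i \<in> {1..m}" "j \<in> {1..m}" by (auto simp: doubleton_eq_iff)
    then have "\<exists>a b. {u, Suc m} = {a, b} \<and> a < b \<and> a \<in> {1..Suc m} \<and> b \<in> {1..Suc m}"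
      if "u \<in> {i, j}" for u
      using that by (intro exI[of _ u] exI[of _ "Suc m"]) auto
    moreover have "\<exists>a b. e = {a, b} \<and> a < b \<and> a \<in> {1..Suc m} \<and> b \<in> {1..Suc m}" if "e \<in> T"
      using attach.IH[OF that] by fastforce
    ultimately show ?case using attach.prems by blast
  qed
  then show ?thesis using that by blast
qed

lemma two_tree_finite: "two_tree m T A \<Longrightarrow> finite T"
  by (induction rule: two_tree.induct) auto

lemma two_tree_vertices:
  assumes "two_tree m T A" and "{i, j} \<in> T"
  shows "i \<in> {1..m}" "j \<in> {1..m}" "i \<noteq> j"
  using two_tree_edge[OF assms] by (metis doubleton_eq_iff less_irrefl)+

lemma two_tree_triangle:
  assumes "two_tree m T A" and "({i, j}, k) \<in> A"
  shows "{i, j} \<in> T" "{i, k} \<in> T" "{j, k} \<in> T" "3 \<le> k"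
proof -
  have "{i, j} \<in> T \<and> {i, k} \<in> T \<and> {j, k} \<in> T \<and> 3 \<le> k"
    using assms
  proof (induction rule: two_tree.induct)
    case (attach m T A a b)
    have "{i, j} = {a, b} \<and> k = Suc m \<or> ({i, j}, k) \<in> A"
      using attach.prems by auto
    then show ?case
    proof
      assume "{i, j} = {a, b} \<and> k = Suc m"
      moreover from this have "i = a \<and> j = b \<or> i = b \<and> j = a"
        by (simp add: doubleton_eq_iff)
      ultimately show ?thesis using attach.hyps two_tree_ge_2[OF attach.hyps(1)] by auto
    next
      assume "({i, j}, k) \<in> A"
      then show ?thesis using attach.IH by blast
    qed
  qed auto
  then show "{i, j} \<in> T" "{i, k} \<in> T" "{j, k} \<in> T" "3 \<le> k" by auto
qed

lemma child_edges:
  assumes "two_tree m T A" and "child A e f"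
  shows "e \<in> T" "f \<in> T" "f \<noteq> {1, 2}"
proof -
  obtain i j k where *: "({i, j}, k) \<in> A" "e = {i, j}" "f = {i, k}"
    using assms(2) unfolding child_def by blast
  show "e \<in> T" "f \<in> T" "f \<noteq> {1, 2}"
    using two_tree_triangle[OF assms(1) *(1)] * by (auto simp: doubleton_eq_iff)
qed

lemma descendant_edge:
  assumes "two_tree m T A" and "descendant A e f" and "e \<in> T - {{1, 2}}"
  shows "f \<in> T - {{1, 2}}"
  using assms(2) unfolding descendant_def
proof (cases rule: rtranclp.cases)
  case rtrancl_refl
  then show ?thesis using assms(3) by simp
next
  case (rtrancl_into_rtrancl g)
  then show ?thesis using child_edges[OF assms(1)] by blast
qed

text \<open>
  Descent between different edges starts and ends with a parent-child step, which stays inside the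
  tree. Outside the tree the descendant relation is therefore the identity.
\<close>

lemma descendant_outside:
  assumes "two_tree m T A" and "descendant A e f" and "e \<notin> T \<or> f \<notin> T"
  shows "e = f"
proof (rule ccontr)
  assume ne: "e \<noteq> f"
  have rt: "(child A)\<^sup>*\<^sup>* e f" using assms(2) by (simp add: descendant_def)
  obtain g where "child A e g"
    using converse_rtranclpE[OF rt] ne by blast
  moreover obtain h where "child A h f"
    using rtranclp.cases[OF rt] ne by metis
  ultimately show False using child_edges[OF assms(1)] assms(3) by blast
qed

text \<open>
  The step shared by all inductions over the construction below: a new vertex \<open>k\<close> is attached to the edge \<open>{i, j}\<close>.
\<close>

locale attach_vertex =
  fixes m :: nat and T :: "nat set set" and A :: "(nat set \<times> nat) set" and i j :: nat
  assumes tree: "two_tree m T A" and edge: "{i, j} \<in> T"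
begin

abbreviation "k \<equiv> Suc m"
abbreviation "T' \<equiv> T \<union> {{i, k}, {j, k}}"
abbreviation "A' \<equiv> insert ({i, j}, k) A"

lemma i_in: "i \<in> {1..m}" and j_in: "j \<in> {1..m}" and i_neq_j: "i \<noteq> j"
  using two_tree_vertices[OF tree edge] by auto

lemma tree': "two_tree k T' A'"
  using two_tree.attach[OF tree edge i_neq_j] .

lemma new_edge: "{u, k} \<notin> T" "{k, u} \<notin> T"
  using two_tree_vertices[OF tree] by fastforce+

lemma child_attach: "child A' e f \<longleftrightarrow> child A e f \<or> e = {i, j} \<and> f \<in> {{i, k}, {j, k}}"
  unfolding child_def by (auto simp: doubleton_eq_iff)

lemma descendant_old:
  assumes "f \<in> T"
  shows "descendant A' e f \<longleftrightarrow> descendant A e f"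
proof
  assume "descendant A' e f"
  then have "(child A')\<^sup>*\<^sup>* e f" by (simp add: descendant_def)
  then have "(child A)\<^sup>*\<^sup>* e f" using assms
  proof (induction rule: rtranclp_induct)
    case (step g f)
    then have "child A g f" using child_attach new_edge by auto
    then show ?case using step child_edges[OF tree] by (meson rtranclp.rtrancl_into_rtrancl)
  qed simp
  then show "descendant A e f" by (simp add: descendant_def)
next
  assume "descendant A e f"
  then show "descendant A' e f" unfolding descendant_def
    by (rule rtranclp_mono[THEN predicate2D, rotated]) (use child_attach in auto)
qed

lemma descendant_new:
  assumes "u \<in> {i, j}"
  shows "descendant A' e {u, k} \<longleftrightarrow> e = {u, k} \<or> descendant A e {i, j}"
proof
  assume "descendant A' e {u, k}"
  then have "(child A')\<^sup>*\<^sup>* e {u, k}" by (simp add: descendant_def)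
  then show "e = {u, k} \<or> descendant A e {i, j}"
  proof (cases rule: rtranclp.cases)
    case (rtrancl_into_rtrancl g)
    then have "g = {i, j}"
      using child_edges(2)[OF tree, of g "{u, k}"] new_edge(1)[of u]
      unfolding child_attach by blast
    then show ?thesis
      using rtrancl_into_rtrancl(1) descendant_old[OF edge] by (simp add: descendant_def)
  qed simp
next
  assume "e = {u, k} \<or> descendant A e {i, j}"
  moreover have "child A' {i, j} {u, k}" using assms child_attach by auto
  ultimately show "descendant A' e {u, k}"
    using descendant_old[OF edge] unfolding descendant_def
    by (metis rtranclp.rtrancl_into_rtrancl rtranclp.rtrancl_refl)
qed

lemma descendants_attach:
  assumes "e \<in> T"
  shows "{f. descendant A' e f} =
    {f. descendant A e f} \<union> (if descendant A e {i, j} then {{i, k}, {j, k}} else {})"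
proof -
  have *: "descendant A' e f \<longleftrightarrow>
      descendant A e f \<or> descendant A e {i, j} \<and> f \<in> {{i, k}, {j, k}}" for f
  proof (cases "f \<in> T")
    case True
    then have "f \<notin> {{i, k}, {j, k}}" using new_edge by blast
    then show ?thesis using descendant_old[OF True] by blast
  next
    case False
    have no: "\<not> descendant A e f"
      using descendant_outside[OF tree] assms False by blast
    show ?thesis
    proof (cases "f \<in> {{i, k}, {j, k}}")
      case True
      then obtain u where u: "u \<in> {i, j}" "f = {u, k}" by blast
      then have "e \<noteq> f" using assms False by blast
      then show ?thesis using descendant_new[OF u(1), of e, folded u(2)] no True by metis
    next
      case f: False
      then have "\<not> descendant A' e f"
        using descendant_outside[OF tree', of e f] assms False by blast
      then show ?thesis using no f by blast
    qed
  qed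
  show ?thesis
    by (rule set_eqI) (simp add: *)
qed

lemma bracket_new:
  assumes "u \<in> {i, j}"
  shows "bracket A' s {u, k} = s {u, k}"
proof -
  have "f = {u, k}" if d: "descendant A' {u, k} f" for f
  proof (cases "f \<in> T")
    case True
    then show ?thesis
      using d descendant_old descendant_outside[OF tree] new_edge by blast
  next
    case False
    have "\<not> descendant A {u, k} {i, j}"
      using descendant_outside[OF tree] new_edge edge by metis
    moreover have "f = {u, k} \<or> f = {i, k} \<or> f = {j, k}"
      using False descendant_outside[OF tree' d] by auto
    ultimately show ?thesis using d descendant_new[of i] descendant_new[of j] by auto
  qed
  moreover have "descendant A' {u, k} {u, k}" by (simp add: descendant_def)
  ultimately have "{f. descendant A' {u, k} f} = {{u, k}}" by blast
  then show ?thesis by (simp add: bracket_def)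
qed

text \<open>
  The weights that the smaller tree must carry once \<open>k\<close> is removed: those of the two edges at \<open>k\<close>
  move to their parent. The parent \<open>{1, 2}\<close> is treated like any other: its weight only ever multiplies
  derivatives of the constant \<open>y 2 - y 1\<close>.
\<close>

definition transfer :: "(nat set \<Rightarrow> complex) \<Rightarrow> nat set \<Rightarrow> complex" where
  "transfer s = s({i, j} := s {i, j} + (s {i, k} + s {j, k}))"

lemma sum_transfer:
  assumes "finite S"
  shows "(\<Sum>f\<in>S. transfer s f * c f) =
    (\<Sum>f\<in>S. s f * c f) + (if {i, j} \<in> S then (s {i, k} + s {j, k}) * c {i, j} else 0)"
proof -
  have "transfer s f * c f =
      s f * c f + (if f = {i, j} then (s {i, k} + s {j, k}) * c {i, j} else 0)" for f
    by (simp add: transfer_def algebra_simps)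
  then show ?thesis using assms by (simp add: sum.distrib)
qed

lemma new_edges_distinct: "{i, k} \<noteq> {j, k}"
  using i_neq_j by (simp add: doubleton_eq_iff)

text \<open>
  An old edge gains \<open>{i, k}\<close> and \<open>{j, k}\<close> as descendants exactly when it has \<open>{i, j}\<close> as one, so
  their weights may equally well be counted at \<open>{i, j}\<close>.
\<close>

lemma bracket_old:
  assumes "e \<in> T"
  shows "bracket A' s e = bracket A (transfer s) e"
proof -
  have sub: "{f. descendant A e f} \<subseteq> T"
    using descendant_outside[OF tree] assms by blast
  then have fin: "finite {f. descendant A e f}"
    using two_tree_finite[OF tree] finite_subset by blast
  have disj: "{f. descendant A e f} \<inter> {{i, k}, {j, k}} = {}"
    using sub new_edge by auto
  have "bracket A' s e =
      bracket A s e + (if descendant A e {i, j} then s {i, k} + s {j, k} else 0)"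
  proof (cases "descendant A e {i, j}")
    case True
    have "sum s ({f. descendant A e f} \<union> {{i, k}, {j, k}}) =
        sum s {f. descendant A e f} + sum s {{i, k}, {j, k}}"
      by (rule sum.union_disjoint[OF fin _ disj]) simp
    then show ?thesis
      using True new_edges_distinct by (simp add: bracket_def descendants_attach[OF assms])
  qed (simp add: bracket_def descendants_attach[OF assms])
  then show ?thesis
    using sum_transfer[OF fin, of s "\<lambda>_. 1"] by (simp add: bracket_def)
qed

lemma ancestral_triangles_old:
  assumes "e \<in> T"
  shows "ancestral_triangles A' e = ancestral_triangles A e"
proof -
  have "\<not> descendant A {u, k} e" for u
    using descendant_outside[OF tree] assms new_edge by metis
  then show ?thesis
    unfolding ancestral_triangles_def using descendant_old[OF assms] by auto
qed

lemma triangle_not_new: "({a, b}, c) \<in> A \<Longrightarrow> a \<noteq> k \<and> b \<noteq> k \<and> c \<noteq> k"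
  using two_tree_triangle[OF tree] new_edge by metis

text \<open>
  The only parent of \<open>{i, k}\<close> is \<open>{i, j}\<close>, hence the ancestral triangles besides the new one are
  those of the parent. This is the recursion behind the product formula.
\<close>

lemma ancestral_triangles_new:
  "ancestral_triangles A' {i, k} = insert (i, j, k) (ancestral_triangles A {i, j})"
proof -
  have "\<not> descendant A {u, k} {i, j}" for u
    using descendant_outside[OF tree] edge new_edge by metis
  then show ?thesis
    using triangle_not_new i_in j_in
    by (auto simp: ancestral_triangles_def descendant_new doubleton_eq_iff)
qed

end

section \<open>Critical points and triangle relations\<close>

text \<open>
  The partial derivative of \<open>log (y (Max e) - y (Min e))\<close> with respect to \<open>y v\<close>.
\<close>

definition dlog :: "nat set \<Rightarrow> nat \<Rightarrow> (nat \<Rightarrow> complex) \<Rightarrow> complex" where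
  "dlog e v y = (of_bool (v = Max e) - of_bool (v = Min e)) / (y (Max e) - y (Min e))"

text \<open>
  The sign of the difference cancels in a logarithmic derivative, so both orders of the endpoints
  give the same value.
\<close>

lemma dlog_pair:
  "dlog {i, j} v y = (of_bool (v = i) - of_bool (v = j)) / (y i - y j)"
proof (cases "i \<le> j")
  case True
  then have "dlog {i, j} v y = (of_bool (v = j) - of_bool (v = i)) / (y j - y i)"
    by (simp add: dlog_def max_def min_def)
  also have "\<dots> = - (of_bool (v = j) - of_bool (v = i)) / - (y j - y i)"
    by (simp only: minus_divide_divide)
  finally show ?thesis by simp
qed (simp add: dlog_def max_def min_def)

text \<open>
  Vertices \<open>1\<close> and \<open>2\<close> are held fixed, so only the vertices from \<open>3\<close> on impose an equation. For these
  \<open>dlog {1, 2} v y = 0\<close>, which is why the sum can run over all of \<open>T\<close>.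
\<close>

definition critical_configuration ::
  "nat \<Rightarrow> nat set set \<Rightarrow> (nat set \<Rightarrow> complex) \<Rightarrow> (nat \<Rightarrow> complex) \<Rightarrow> bool" where
  "critical_configuration m T s y \<longleftrightarrow>
     (\<forall>e\<in>T. y (Max e) \<noteq> y (Min e)) \<and> (\<forall>v\<in>{3..m}. (\<Sum>e\<in>T. s e * dlog e v y) = 0)"

text \<open>
  Since \<open>{i, j} = {j, i}\<close>, the next two definitions quantify over both labellings of a triangle.
  In particular, \<open>nondegenerate\<close> makes \<open>b\<close> nonzero on both child edges, while the two instances of the
  triangle relation are equivalent to each other.
\<close>

definition nondegenerate :: "(nat set \<times> nat) set \<Rightarrow> (nat set \<Rightarrow> complex) \<Rightarrow> bool" where
  "nondegenerate A b \<longleftrightarrow>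
     (\<forall>i j k. ({i, j}, k) \<in> A \<longrightarrow> b {i, k} \<noteq> 0 \<and> b {i, k} + b {j, k} \<noteq> 0)"

definition triangle_relations ::
  "(nat set \<times> nat) set \<Rightarrow> (nat set \<Rightarrow> complex) \<Rightarrow> (nat \<Rightarrow> complex) \<Rightarrow> bool" where
  "triangle_relations A b y \<longleftrightarrow>
     (\<forall>i j k. ({i, j}, k) \<in> A \<longrightarrow>
        (y k - y i) * (b {i, k} + b {j, k}) = b {i, k} * (y j - y i))"

lemma nondegenerate_cong:
  assumes "two_tree m T A" and "\<And>e. e \<in> T \<Longrightarrow> b e = b' e"
  shows "nondegenerate A b \<longleftrightarrow> nondegenerate A b'"
  unfolding nondegenerate_def using two_tree_triangle(2,3)[OF assms(1)] assms(2)
  by (metis (no_types, lifting))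

lemma triangle_relations_cong:
  assumes "two_tree m T A" and "\<And>e. e \<in> T \<Longrightarrow> b e = b' e"
    and "\<And>v. v \<in> {1..m} \<Longrightarrow> y v = y' v"
  shows "triangle_relations A b y \<longleftrightarrow> triangle_relations A b' y'"
proof -
  have "b {i, k} = b' {i, k} \<and> b {j, k} = b' {j, k} \<and> y i = y' i \<and> y j = y' j \<and> y k = y' k"
    if "({i, j}, k) \<in> A" for i j k
    using two_tree_triangle(1-3)[OF assms(1) that] two_tree_vertices(1,2)[OF assms(1)] assms(2,3)
    by blast
  then show ?thesis unfolding triangle_relations_def by (metis (no_types, lifting))
qed

text \<open>
  The critical equation of a vertex with only two neighbours, at \<open>p\<close> and \<open>q\<close>. The linear form on
  the left already forces \<open>z\<close> away from both neighbours, so it captures the nonvanishing conditions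
  as well.
\<close>

lemma balance_two_points:
  fixes a b p q z :: complex
  assumes "a \<noteq> 0" "b \<noteq> 0" "a + b \<noteq> 0" "p \<noteq> q"
  shows "(z - p) * (a + b) = a * (q - p) \<longleftrightarrow>
    z \<noteq> p \<and> z \<noteq> q \<and> a / (z - p) + b / (z - q) = 0"
proof
  assume *: "(z - p) * (a + b) = a * (q - p)"
  then have "(z - q) * (a + b) = b * (p - q)" by (simp add: algebra_simps)
  then have ne: "z \<noteq> p" "z \<noteq> q" using * assms by auto
  have "a * (z - q) + b * (z - p) = 0" using * by (simp add: algebra_simps)
  then show "z \<noteq> p \<and> z \<noteq> q \<and> a / (z - p) + b / (z - q) = 0"
    using ne by (simp add: add_frac_eq)
next
  assume *: "z \<noteq> p \<and> z \<noteq> q \<and> a / (z - p) + b / (z - q) = 0"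
  then have "(a * (z - q) + b * (z - p)) / ((z - p) * (z - q)) = 0"
    using add_frac_eq[of "z - p" "z - q" a b] by simp
  then have "a * (z - q) + b * (z - p) = 0" using * by simp
  then show "(z - p) * (a + b) = a * (q - p)" by (simp add: algebra_simps)
qed

context attach_vertex
begin

lemma swapped: "attach_vertex m T A j i"
  using tree edge by unfold_locales (simp_all add: insert_commute)

lemma nondegenerate_attach:
  "nondegenerate A' b \<longleftrightarrow>
     nondegenerate A b \<and> b {i, k} \<noteq> 0 \<and> b {j, k} \<noteq> 0 \<and> b {i, k} + b {j, k} \<noteq> 0"
  unfolding nondegenerate_def by (auto simp: doubleton_eq_iff add.commute)

lemma triangle_relations_attach:
  "triangle_relations A' b y \<longleftrightarrow>
     triangle_relations A b y \<and> (y k - y i) * (b {i, k} + b {j, k}) = b {i, k} * (y j - y i)"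
proof -
  have "(y k - y j) * (b {j, k} + b {i, k}) = b {j, k} * (y i - y j) \<longleftrightarrow>
      (y k - y i) * (b {i, k} + b {j, k}) = b {i, k} * (y j - y i)"
    by (auto simp: algebra_simps)
  then show ?thesis
    unfolding triangle_relations_def by (auto simp: doubleton_eq_iff)
qed

text \<open>
  Removing the last vertex: the equation at \<open>k\<close> becomes the triangle relation, and this relation
  makes the edges \<open>{i, k}\<close> and \<open>{j, k}\<close> act on the other vertices like additional weight on \<open>{i, j}\<close>.
\<close>

lemma critical_configuration_attach:
  assumes s: "s {i, k} \<noteq> 0" "s {j, k} \<noteq> 0" "s {i, k} + s {j, k} \<noteq> 0"
  shows "critical_configuration k T' s y \<longleftrightarrow>
    critical_configuration m T (transfer s) y \<and>
    (y k - y i) * (s {i, k} + s {j, k}) = s {i, k} * (y j - y i)"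
    (is "?L \<longleftrightarrow> ?R \<and> ?rel")
proof -
  have nonvanishing: "(\<forall>e\<in>T'. y (Max e) \<noteq> y (Min e)) \<longleftrightarrow>
      (\<forall>e\<in>T. y (Max e) \<noteq> y (Min e)) \<and> y k \<noteq> y i \<and> y k \<noteq> y j"
    using i_in j_in by (auto simp: max_def min_def)
  have ij: "y i \<noteq> y j" if "\<forall>e\<in>T. y (Max e) \<noteq> y (Min e)"
    using that edge by (auto simp: max_def min_def split: if_splits dest!: bspec[where x = "{i, j}"])
  have sum': "(\<Sum>e\<in>T'. s e * dlog e v y) =
      (\<Sum>e\<in>T. s e * dlog e v y) + (s {i, k} * dlog {i, k} v y + s {j, k} * dlog {j, k} v y)" for v
  proof -
    have "(\<Sum>e\<in>T'. s e * dlog e v y) =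
        (\<Sum>e\<in>T. s e * dlog e v y) + (\<Sum>e\<in>{{i, k}, {j, k}}. s e * dlog e v y)"
      using two_tree_finite[OF tree] new_edge by (intro sum.union_disjoint) auto
    then show ?thesis using new_edges_distinct by simp
  qed
  have sum_new: "(\<Sum>e\<in>T'. s e * dlog e k y) = s {i, k} / (y k - y i) + s {j, k} / (y k - y j)"
  proof -
    have "dlog e k y = 0" if "e \<in> T" for e
      using two_tree_edge[OF tree that] by (fastforce simp: dlog_pair)
    moreover have "dlog {u, k} k y = 1 / (y k - y u)" if "u \<noteq> k" for u
      using that dlog_pair[of k u] by (simp add: insert_commute)
    ultimately show ?thesis using i_in j_in unfolding sum' by simp
  qed
  \<comment> \<open>At \<open>i\<close> the relation reads \<open>s {i, k} / (y i - y k) = (s {i, k} + s {j, k}) / (y i - y j)\<close>,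
    and symmetrically at \<open>j\<close>; the remaining old vertices do not see the triangle.\<close>
  have sum_old: "(\<Sum>e\<in>T'. s e * dlog e v y) = (\<Sum>e\<in>T. transfer s e * dlog e v y)"
    if "?rel" "y i \<noteq> y j" "v \<noteq> k" for v
  proof -
    have ne: "y k \<noteq> y i" "y k \<noteq> y j" and bal: "s {i, k} / (y k - y i) + s {j, k} / (y k - y j) = 0"
      using balance_two_points[OF s that(2)] that(1) by auto
    have rel': "(y k - y j) * (s {i, k} + s {j, k}) = s {j, k} * (y i - y j)"
      using that(1) by (simp add: algebra_simps)
    have "s {i, k} / (y i - y k) = (s {i, k} + s {j, k}) / (y i - y j)"
      using ne that(1,2) by (simp add: frac_eq_eq) (simp add: algebra_simps)
    then have i_term: "s {i, k} * dlog {i, k} v y =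
        of_bool (v = i) * ((s {i, k} + s {j, k}) / (y i - y j))"
      using that(3) by (simp add: dlog_pair)
    have "s {j, k} / (y j - y k) = (s {i, k} + s {j, k}) / (y j - y i)"
      using ne rel' that(2) by (simp add: frac_eq_eq) (simp add: algebra_simps)
    also have "\<dots> = - ((s {i, k} + s {j, k}) / (y i - y j))"
      by (metis minus_diff_eq minus_divide_right)
    finally have j_term: "s {j, k} * dlog {j, k} v y =
        of_bool (v = j) * - ((s {i, k} + s {j, k}) / (y i - y j))"
      using that(3) by (simp add: dlog_pair)
    have ij_term: "(s {i, k} + s {j, k}) * dlog {i, j} v y =
        (of_bool (v = i) - of_bool (v = j)) * ((s {i, k} + s {j, k}) / (y i - y j))"
      by (simp add: dlog_pair)
    have "s {i, k} * dlog {i, k} v y + s {j, k} * dlog {j, k} v y =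
        (s {i, k} + s {j, k}) * dlog {i, j} v y"
      by (simp only: i_term j_term ij_term left_diff_distrib mult_minus_right add_uminus_conv_diff)
    then show ?thesis
      unfolding sum' using sum_transfer[OF two_tree_finite[OF tree], of s "\<lambda>e. dlog e v y"] edge by simp
  qed
  have split: "{3..k} = insert k {3..m}" using two_tree_ge_2[OF tree] by auto
  show ?thesis
  proof
    assume L: ?L
    then have nv: "\<forall>e\<in>T. y (Max e) \<noteq> y (Min e)" and ne: "y k \<noteq> y i" "y k \<noteq> y j"
      using nonvanishing by (auto simp: critical_configuration_def)
    have "s {i, k} / (y k - y i) + s {j, k} / (y k - y j) = 0"
      using L sum_new split by (simp add: critical_configuration_def)
    then have rel: ?rel using balance_two_points[OF s ij[OF nv]] ne by blast
    have "(\<Sum>e\<in>T. transfer s e * dlog e v y) = 0" if "v \<in> {3..m}" for v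
      using sum_old[OF rel ij[OF nv], of v] L that by (auto simp: critical_configuration_def)
    then show "?R \<and> ?rel" using nv rel by (simp add: critical_configuration_def)
  next
    assume R: "?R \<and> ?rel"
    then have nv: "\<forall>e\<in>T. y (Max e) \<noteq> y (Min e)" by (simp add: critical_configuration_def)
    have ne: "y k \<noteq> y i" "y k \<noteq> y j" and bal: "s {i, k} / (y k - y i) + s {j, k} / (y k - y j) = 0"
      using balance_two_points[OF s ij[OF nv]] R by auto
    have "(\<Sum>e\<in>T'. s e * dlog e v y) = 0" if "v \<in> {3..m}" for v
      using sum_old[OF _ ij[OF nv], of v] R that by (auto simp: critical_configuration_def)
    moreover have "\<forall>e\<in>T'. y (Max e) \<noteq> y (Min e)" using nv ne nonvanishing by blast
    ultimately show ?L
      unfolding critical_configuration_def split using sum_new bal by simp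
  qed
qed

end

text \<open>
  Removing vertices one at a time turns all critical equations into triangle relations. The weight on
  an edge at the moment when it is removed together with its larger endpoint is its bracket.
\<close>

lemma critical_iff_triangle_relations:
  assumes "two_tree m T A" and "nondegenerate A (bracket A s)" and "y 1 \<noteq> y 2"
  shows "critical_configuration m T s y \<longleftrightarrow> triangle_relations A (bracket A s) y"
  using assms(1,2)
proof (induction arbitrary: s rule: two_tree.induct)
  case base
  then show ?case using assms(3)
    by (simp add: critical_configuration_def triangle_relations_def numeral_2_eq_2)
next
  case (attach m T A i j)
  interpret attach_vertex m T A i j
    using attach.hyps by unfold_locales
  have b: "bracket A' s {i, k} = s {i, k}" "bracket A' s {j, k} = s {j, k}"
    using bracket_new by auto
  have "nondegenerate A (bracket A' s)"
    using attach.prems unfolding nondegenerate_attach by simp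
  moreover have "nondegenerate A (bracket A' s) \<longleftrightarrow> nondegenerate A (bracket A (transfer s))"
    by (rule nondegenerate_cong[OF tree bracket_old])
  ultimately have "nondegenerate A (bracket A (transfer s))" by simp
  then have "critical_configuration m T (transfer s) y \<longleftrightarrow>
      triangle_relations A (bracket A (transfer s)) y"
    by (rule attach.IH)
  moreover have "triangle_relations A (bracket A' s) y \<longleftrightarrow>
      triangle_relations A (bracket A (transfer s)) y"
    by (rule triangle_relations_cong[OF tree bracket_old refl])
  moreover have "s {i, k} \<noteq> 0" "s {j, k} \<noteq> 0" "s {i, k} + s {j, k} \<noteq> 0"
    using attach.prems unfolding nondegenerate_attach b by simp_all
  note critical_configuration_attach[where y = y, OF this]
  ultimately show ?case
    unfolding triangle_relations_attach b by blast
qed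

section \<open>Solving the triangle relations\<close>

lemma triangle_relations_solvable:
  assumes "two_tree m T A" and "nondegenerate A b"
  shows "\<exists>y. y 1 = p \<and> y 2 = q \<and> triangle_relations A b y"
  using assms
proof (induction rule: two_tree.induct)
  case base
  show ?case
    by (rule exI[of _ "\<lambda>v. if v = 1 then p else q"]) (simp add: triangle_relations_def)
next
  case (attach m T A i j)
  interpret attach_vertex m T A i j
    using attach.hyps by unfold_locales
  have nd: "nondegenerate A b" "b {i, k} + b {j, k} \<noteq> 0"
    using attach.prems nondegenerate_attach by auto
  obtain y where y: "y 1 = p" "y 2 = q" "triangle_relations A b y"
    using attach.IH nd by blast
  define y' where "y' = y(k := y i + b {i, k} / (b {i, k} + b {j, k}) * (y j - y i))"
  have "triangle_relations A b y'"
    using y(3) triangle_relations_cong[OF tree refl, of y' y b] by (simp add: y'_def)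
  moreover have "(y' k - y' i) * (b {i, k} + b {j, k}) = b {i, k} * (y' j - y' i)"
    using i_in j_in nd by (simp add: y'_def)
  moreover have "y' 1 = p" "y' 2 = q"
    using y two_tree_ge_2[OF tree] by (auto simp: y'_def)
  ultimately show ?case using triangle_relations_attach by blast
qed

lemma triangle_relations_unique:
  assumes "two_tree m T A" and "nondegenerate A b"
    and "triangle_relations A b y" and "triangle_relations A b y'"
    and "y 1 = y' 1" and "y 2 = y' 2" and "v \<in> {1..m}"
  shows "y v = y' v"
  using assms(1,2,3,4,7)
proof (induction arbitrary: v rule: two_tree.induct)
  case base
  then have "v = 1 \<or> v = 2" by auto
  then show ?case using assms(5,6) by auto
next
  case (attach m T A i j)
  interpret attach_vertex m T A i j
    using attach.hyps by unfold_locales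
  have old: "y v = y' v" if "v \<in> {1..m}" for v
    using attach.IH[OF _ _ _ that] attach.prems nondegenerate_attach triangle_relations_attach
    by blast
  have "(y k - y i) * (b {i, k} + b {j, k}) = (y' k - y' i) * (b {i, k} + b {j, k})"
    using attach.prems triangle_relations_attach old[OF i_in] old[OF j_in] by simp
  then have "y k = y' k"
    using attach.prems(1) nondegenerate_attach old[OF i_in] by simp
  then show ?case using old[of v] attach.prems(4) by (cases "v = k") auto
qed

lemma finite_triangles:
  assumes "two_tree m T A"
  shows "finite {(i, j, k). ({i, j}, k) \<in> A}"
proof (rule finite_subset)
  show "{(i, j, k). ({i, j}, k) \<in> A} \<subseteq> {1..m} \<times> {1..m} \<times> {1..m}"
    using two_tree_triangle(1-3)[OF assms] two_tree_vertices(1,2)[OF assms] by blast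
qed simp

lemma finite_ancestral_triangles:
  assumes "two_tree m T A"
  shows "finite (ancestral_triangles A e)"
  by (rule finite_subset[OF _ finite_triangles[OF assms]]) (auto simp: ancestral_triangles_def)

text \<open>
  The sign is quantified outside \<open>b\<close> and \<open>y\<close>, as it may depend on the tree and the edge only. The
  factor \<open>y 2 - y 1\<close> is the difference along the root edge.
\<close>

definition signed_product_formula :: "(nat set \<times> nat) set \<Rightarrow> nat set \<Rightarrow> complex \<Rightarrow> bool" where
  "signed_product_formula A e \<sigma> \<longleftrightarrow>
     (\<forall>b y. nondegenerate A b \<longrightarrow> triangle_relations A b y \<longrightarrow>
        y (Max e) - y (Min e) = \<sigma> * (y 2 - y 1) *
          (\<Prod>(i, j, k)\<in>ancestral_triangles A e. b {i, k} / (b {i, k} + b {j, k})))"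

context attach_vertex
begin

lemma signed_product_formula_old:
  assumes "e \<in> T" and "signed_product_formula A e \<sigma>"
  shows "signed_product_formula A' e \<sigma>"
  using assms(2) unfolding signed_product_formula_def
  by (simp add: ancestral_triangles_old[OF assms(1)] nondegenerate_attach triangle_relations_attach)

text \<open>
  The triangle relation yields \<open>y k - y i\<close> from \<open>y j - y i\<close>. As \<open>k\<close> is the largest vertex, the first
  difference is oriented from minimum to maximum, while the second one is so only if \<open>i < j\<close>.
\<close>

lemma signed_product_formula_new:
  assumes "signed_product_formula A {i, j} \<sigma>"
  shows "signed_product_formula A' {i, k} (if i < j then \<sigma> else - \<sigma>)"
  unfolding signed_product_formula_def
proof (intro allI impI)
  fix b y
  assume nd: "nondegenerate A' b" and rel: "triangle_relations A' b y"
  define w where "w = (\<lambda>(i, j, k). b {i, k} / (b {i, k} + b {j, k}))"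
  have w: "y k - y i = w (i, j, k) * (y j - y i)"
    using nd rel by (simp add: w_def nondegenerate_attach triangle_relations_attach field_simps)
  have "(i, j, k) \<notin> ancestral_triangles A {i, j}"
    using triangle_not_new by (auto simp: ancestral_triangles_def)
  then have prod: "prod w (ancestral_triangles A' {i, k}) =
      w (i, j, k) * prod w (ancestral_triangles A {i, j})"
    unfolding ancestral_triangles_new using finite_ancestral_triangles[OF tree] by simp
  have "y (Max {i, j}) - y (Min {i, j}) =
      \<sigma> * (y 2 - y 1) * prod w (ancestral_triangles A {i, j})"
    using assms nd rel unfolding signed_product_formula_def w_def
    by (auto simp: nondegenerate_attach triangle_relations_attach)
  then have "y j - y i = (if i < j then \<sigma> else - \<sigma>) * (y 2 - y 1) *
      prod w (ancestral_triangles A {i, j})"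
    using i_neq_j by (auto simp: max_def min_def algebra_simps split: if_splits)
  then have "y k - y i = (if i < j then \<sigma> else - \<sigma>) * (y 2 - y 1) *
      prod w (ancestral_triangles A' {i, k})"
    unfolding w prod by (simp add: mult_ac)
  moreover have "Max {i, k} = k" "Min {i, k} = i" using i_in by auto
  ultimately show "y (Max {i, k}) - y (Min {i, k}) =
      (if i < j then \<sigma> else - \<sigma>) * (y 2 - y 1) *
      (\<Prod>(i, j, k)\<in>ancestral_triangles A' {i, k}. b {i, k} / (b {i, k} + b {j, k}))"
    unfolding w_def by simp
qed

end

lemma signed_product_formula_exists:
  assumes "two_tree m T A" and "e \<in> T"
  shows "\<exists>\<sigma>\<in>{1, -1}. signed_product_formula A e \<sigma>"
  using assms
proof (induction arbitrary: e rule: two_tree.induct)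
  case base
  have "ancestral_triangles {} e = {}" by (simp add: ancestral_triangles_def)
  then have "signed_product_formula {} e 1"
    using base by (simp add: signed_product_formula_def numeral_2_eq_2)
  then show ?case by blast
next
  case (attach m T A i j)
  interpret attach_vertex m T A i j
    using attach.hyps by unfold_locales
  interpret swap: attach_vertex m T A j i
    by (rule swapped)
  obtain \<sigma> where \<sigma>: "\<sigma> \<in> {1, -1}" "signed_product_formula A {i, j} \<sigma>"
    using attach.IH[OF edge] by blast
  consider "e \<in> T" | "e = {i, k}" | "e = {j, k}" using attach.prems by blast
  then show ?case
  proof cases
    case 1
    then show ?thesis using attach.IH signed_product_formula_old by blast
  next
    case 2
    then show ?thesis
      using signed_product_formula_new[OF \<sigma>(2)] \<sigma>(1) by (auto split: if_splits)
  next
    case 3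
    have "signed_product_formula A' {j, k} (if j < i then \<sigma> else - \<sigma>)"
      using swap.signed_product_formula_new \<sigma>(2) by (simp add: insert_commute)
    then show ?thesis using 3 \<sigma>(1) by (auto split: if_splits)
  qed
qed

section \<open>Derivatives of the potential\<close>

lemma ycoord_update:
  assumes "1 \<le> a" and "1 \<le> j"
  shows "ycoord (x(a := t)) j = (if j = a + 2 then t else ycoord x j)"
  using assms by (auto simp: ycoord_def)

lemma ycoord_has_field_derivative:
  assumes "1 \<le> a" and "1 \<le> j"
  shows "((\<lambda>t. ycoord (x(a := t)) j) has_field_derivative of_bool (a + 2 = j)) (at w)"
  unfolding ycoord_update[OF assms] by (cases "j = a + 2") simp_all

text \<open>The coordinate \<open>a\<close> of the potential belongs to the vertex \<open>a + 2\<close>.\<close>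

lemma potential_has_field_derivative:
  assumes tree: "two_tree m T A" and a: "1 \<le> a"
    and branch: "\<And>e. e \<in> T \<Longrightarrow> log_branch_at (plucker e x) (lg e)"
  shows "((\<lambda>t. potential T s lg (x(a := t))) has_field_derivative
    (\<Sum>e\<in>T. s e * dlog e (a + 2) (ycoord x))) (at (x a))"
proof -
  have "((\<lambda>t. s e * lg e (plucker e (x(a := t)))) has_field_derivative
      s e * dlog e (a + 2) (ycoord x)) (at (x a))" if e: "e \<in> T" for e
  proof -
    obtain i j where ij: "e = {i, j}" "i < j" "1 \<le> i" "1 \<le> j"
      using two_tree_edge[OF tree e] by (metis atLeastAtMost_iff)
    then have Max: "Max e = j" and Min: "Min e = i" by auto
    have "((\<lambda>t. plucker e (x(a := t))) has_field_derivative
        of_bool (a + 2 = j) - of_bool (a + 2 = i)) (at (x a))"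
      unfolding plucker_def Max Min
      by (intro DERIV_diff ycoord_has_field_derivative a ij)
    moreover have "(lg e has_field_derivative 1 / plucker e x) (at (plucker e (x(a := x a))))"
      using log_branch_at_deriv[OF branch[OF e]] by simp
    ultimately have "((\<lambda>t. lg e (plucker e (x(a := t)))) has_field_derivative
        1 / plucker e x * (of_bool (a + 2 = j) - of_bool (a + 2 = i))) (at (x a))"
      by (rule DERIV_chain2[rotated])
    then have "((\<lambda>t. s e * lg e (plucker e (x(a := t)))) has_field_derivative
        s e * (1 / plucker e x * (of_bool (a + 2 = j) - of_bool (a + 2 = i)))) (at (x a))"
      by (rule DERIV_cmult)
    then show ?thesis
      unfolding dlog_def plucker_def Max Min by simp
  qed
  then have "((\<lambda>t. potential T s lg (x(a := t))) has_field_derivative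
      (\<Sum>e\<in>T - {{1, 2}}. s e * dlog e (a + 2) (ycoord x))) (at (x a))"
    unfolding potential_def by (intro DERIV_sum) auto
  moreover have "dlog {1, 2} (a + 2) (ycoord x) = 0"
    using a by (simp add: dlog_pair)
  then have "(\<Sum>e\<in>T - {{1, 2}}. s e * dlog e (a + 2) (ycoord x)) =
      (\<Sum>e\<in>T. s e * dlog e (a + 2) (ycoord x))"
    by (intro sum.mono_neutral_left two_tree_finite[OF tree]) auto
  ultimately show ?thesis by simp
qed

text \<open>
  All branches of the logarithm have the same derivative, so the condition can be read off from any
  choice of branches; a choice exists exactly where the differences do not vanish.
\<close>

lemma critical_point_iff:
  assumes "4 \<le> n" and tree: "two_tree (n - 1) T A"
  shows "critical_point n T s x \<longleftrightarrow>
    x \<in> {1..n-3} \<rightarrow>\<^sub>E UNIV \<and> critical_configuration (n - 1) T s (ycoord x)"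
proof -
  have nz: "plucker e x \<noteq> 0 \<longleftrightarrow> ycoord x (Max e) \<noteq> ycoord x (Min e)" for e
    by (simp add: plucker_def)
  have shift: "{3..n - 1} = (\<lambda>a. a + 2) ` {1..n - 3}"
  proof -
    have "n - 1 = n - 3 + 2" using assms(1) by simp
    then show ?thesis unfolding image_add_atLeastAtMost' by (simp add: numeral_3_eq_3)
  qed
  have deriv: "((\<lambda>t. potential T s lg (x(a := t))) has_field_derivative 0) (at (x a)) \<longleftrightarrow>
      (\<Sum>e\<in>T. s e * dlog e (a + 2) (ycoord x)) = 0"
    if "\<forall>e\<in>T. log_branch_at (plucker e x) (lg e)" "a \<in> {1..n - 3}" for lg a
    using potential_has_field_derivative[OF tree, of a x lg s] that DERIV_unique by auto
  have branches: "\<exists>lg. \<forall>e\<in>T. log_branch_at (plucker e x) (lg e)"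
    if "\<forall>e\<in>T. plucker e x \<noteq> 0"
    using that log_branch_at_exists_iff by (intro bchoice) blast
  show ?thesis
    unfolding critical_point_def critical_configuration_def shift ball_simps nz[symmetric]
    using deriv branches by blast
qed

section \<open>Generic parameters\<close>

text \<open>
  One polynomial whose zeros are the weights to be excluded; it collects every quantity that the
  triangle relations require to be nonzero.
\<close>

definition degeneracy :: "(nat set \<times> nat) set \<Rightarrow> (nat set \<Rightarrow> complex) \<Rightarrow> complex" where
  "degeneracy A s = (\<Prod>(i, j, k)\<in>{(i, j, k). ({i, j}, k) \<in> A}.
     bracket A s {i, k} * (bracket A s {i, k} + bracket A s {j, k}))"

lemma degeneracy_nonzero_iff:
  assumes "two_tree m T A"
  shows "degeneracy A s \<noteq> 0 \<longleftrightarrow> nondegenerate A (bracket A s)"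
  unfolding degeneracy_def nondegenerate_def
  by (auto simp: prod_zero_iff[OF finite_triangles[OF assms]])

lemma polynomial_functions_sum:
  assumes "finite S" and "\<And>f. f \<in> S \<Longrightarrow> p f \<in> polynomial_functions I"
  shows "(\<lambda>s. \<Sum>f\<in>S. p f s) \<in> polynomial_functions I"
  using assms by (induction rule: finite_induct) (auto intro: polynomial_functions.intros)

lemma polynomial_functions_prod:
  assumes "finite S" and "\<And>f. f \<in> S \<Longrightarrow> p f \<in> polynomial_functions I"
  shows "(\<lambda>s. \<Prod>f\<in>S. p f s) \<in> polynomial_functions I"
  using assms by (induction rule: finite_induct) (auto intro: polynomial_functions.intros)

lemma descendants_subset:
  assumes "two_tree m T A" and "e \<in> T - {{1, 2}}"
  shows "{f. descendant A e f} \<subseteq> T - {{1, 2}}"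
  using descendant_edge[OF assms(1) _ assms(2)] by blast

lemma finite_descendants:
  assumes "two_tree m T A" and "e \<in> T - {{1, 2}}"
  shows "finite {f. descendant A e f}"
  using finite_subset[OF descendants_subset[OF assms]] two_tree_finite[OF assms(1)] by simp

lemma two_tree_triangle_children:
  assumes "two_tree m T A" and "({i, j}, k) \<in> A"
  shows "{i, k} \<in> T - {{1, 2}}" "{j, k} \<in> T - {{1, 2}}"
  using two_tree_triangle[OF assms] by (auto simp: doubleton_eq_iff)

lemma degeneracy_polynomial:
  assumes "two_tree m T A"
  shows "degeneracy A \<in> polynomial_functions (T - {{1, 2}})"
proof -
  have bracket: "(\<lambda>s. bracket A s e) \<in> polynomial_functions (T - {{1, 2}})"
    if "e \<in> T - {{1, 2}}" for e
    unfolding bracket_def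
    using descendants_subset[OF assms that]
    by (intro polynomial_functions_sum finite_descendants[OF assms that] polynomial_functions.coord)
      blast
  have "(\<lambda>s. \<Prod>t\<in>{(i, j, k). ({i, j}, k) \<in> A}. (case t of (i, j, k) \<Rightarrow>
      bracket A s {i, k} * (bracket A s {i, k} + bracket A s {j, k})))
    \<in> polynomial_functions (T - {{1, 2}})"
  proof (rule polynomial_functions_prod[OF finite_triangles[OF assms]])
    fix t assume "t \<in> {(i, j, k). ({i, j}, k) \<in> A}"
    then obtain i j k where t: "t = (i, j, k)" "({i, j}, k) \<in> A" by blast
    show "(\<lambda>s. case t of (i, j, k) \<Rightarrow>
        bracket A s {i, k} * (bracket A s {i, k} + bracket A s {j, k}))
      \<in> polynomial_functions (T - {{1, 2}})"
      unfolding t(1) prod.case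
      by (intro polynomial_functions.mult polynomial_functions.add bracket
          two_tree_triangle_children[OF assms t(2)])
  qed
  then show ?thesis unfolding degeneracy_def[abs_def] .
qed

text \<open>With all weights \<open>1\<close>, a bracket is the number of descendants, which is positive.\<close>

lemma nondegenerate_ones:
  assumes "two_tree m T A"
  shows "nondegenerate A (bracket A (\<lambda>e\<in>T - {{1, 2}}. 1))"
proof -
  have *: "\<exists>c>0. bracket A (\<lambda>e\<in>T - {{1, 2}}. 1) e = of_nat c" if "e \<in> T - {{1, 2}}" for e
  proof (intro exI conjI)
    have "descendant A e e" by (simp add: descendant_def)
    then show "0 < card {f. descendant A e f}"
      using finite_descendants[OF assms that] by (auto simp: card_gt_0_iff)
    have "bracket A (\<lambda>e\<in>T - {{1, 2}}. 1) e = (\<Sum>f | descendant A e f. 1)"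
      unfolding bracket_def using descendants_subset[OF assms that] by (intro sum.cong) auto
    then show "bracket A (\<lambda>e\<in>T - {{1, 2}}. 1) e = of_nat (card {f. descendant A e f})"
      by simp
  qed
  show ?thesis
    unfolding nondegenerate_def
  proof (intro allI impI)
    fix i j k assume "({i, j}, k) \<in> A"
    then obtain c d where "c > 0" "d > 0"
      "bracket A (\<lambda>e\<in>T - {{1, 2}}. 1) {i, k} = of_nat c"
      "bracket A (\<lambda>e\<in>T - {{1, 2}}. 1) {j, k} = of_nat d"
      using two_tree_triangle_children[OF assms] * by metis
    then show "bracket A (\<lambda>e\<in>T - {{1, 2}}. 1) {i, k} \<noteq> 0 \<and>
        bracket A (\<lambda>e\<in>T - {{1, 2}}. 1) {i, k} + bracket A (\<lambda>e\<in>T - {{1, 2}}. 1) {j, k} \<noteq> 0"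
      by (simp flip: of_nat_add)
  qed
qed

section \<open>The critical point\<close>

lemma critical_point_iff_triangle_relations:
  assumes "4 \<le> n" and "two_tree (n - 1) T A" and "nondegenerate A (bracket A s)"
  shows "critical_point n T s x \<longleftrightarrow>
    x \<in> {1..n-3} \<rightarrow>\<^sub>E UNIV \<and> triangle_relations A (bracket A s) (ycoord x)"
proof -
  have "ycoord x 1 \<noteq> ycoord x 2" by (simp add: ycoord_def)
  then show ?thesis
    using critical_point_iff[OF assms(1,2)] critical_iff_triangle_relations[OF assms(2,3)] by blast
qed

lemma critical_point_exists_unique:
  assumes n: "4 \<le> n" and tree: "two_tree (n - 1) T A" and nd: "nondegenerate A (bracket A s)"
  shows "\<exists>!x. critical_point n T s x"
proof -
  note iff = critical_point_iff_triangle_relations[OF n tree nd]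
  obtain y where y: "y 1 = 0" "y 2 = 1" "triangle_relations A (bracket A s) y"
    using triangle_relations_solvable[OF tree nd] by blast
  define x where "x = (\<lambda>a\<in>{1..n-3}. y (a + 2))"
  have "ycoord x v = y v" if v: "v \<in> {1..n-1}" for v
  proof -
    consider "v = 1" | "v = 2" | a where "v = a + 2" "a \<in> {1..n-3}"
    proof (cases "v \<le> 2")
      case False
      then have "v = (v - 2) + 2" "v - 2 \<in> {1..n-3}" using v by auto
      then show ?thesis using that(3) by blast
    qed (use v that(1,2) in force)
    then show ?thesis
      using y(1,2) by cases (simp_all add: ycoord_def x_def)
  qed
  then have "triangle_relations A (bracket A s) (ycoord x)"
    using y(3) triangle_relations_cong[OF tree refl, of "ycoord x" y "bracket A s"] by simp
  then have "critical_point n T s x" by (simp add: iff x_def)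
  moreover have "x = x'" if "critical_point n T s x" "critical_point n T s x'" for x x'
  proof (rule PiE_ext)
    show "x \<in> {1..n-3} \<rightarrow>\<^sub>E UNIV" "x' \<in> {1..n-3} \<rightarrow>\<^sub>E UNIV" using that iff by auto
    fix a assume a: "a \<in> {1..n-3}"
    have "triangle_relations A (bracket A s) (ycoord x)"
      "triangle_relations A (bracket A s) (ycoord x')"
      using that iff by auto
    moreover have "ycoord x 1 = ycoord x' 1" "ycoord x 2 = ycoord x' 2"
      by (simp_all add: ycoord_def)
    moreover have "a + 2 \<in> {1..n-1}" using a by auto
    ultimately have "ycoord x (a + 2) = ycoord x' (a + 2)"
      by (rule triangle_relations_unique[OF tree nd])
    then show "x a = x' a" using a by (simp add: ycoord_def)
  qed
  ultimately show ?thesis by blast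
qed

theorem corollary3p3:
  fixes n :: nat and T :: "nat set set" and A :: "(nat set \<times> nat) set"
  assumes "n \<ge> 4" and "two_tree (n - 1) T A"
  shows "\<exists>Z. zariski_closed (T - {{1, 2}}) Z \<and> Z \<subset> (T - {{1, 2}}) \<rightarrow>\<^sub>E UNIV \<and>
    (\<exists>\<epsilon> :: nat set \<Rightarrow> complex. (\<forall>e\<in>T. \<epsilon> e \<in> {1, -1}) \<and>
      (\<forall>s \<in> ((T - {{1, 2}}) \<rightarrow>\<^sub>E UNIV) - Z.
        (\<exists>!x. critical_point n T s x) \<and>
        (\<forall>x. critical_point n T s x \<longrightarrow>
          (\<forall>e\<in>T. plucker e x = \<epsilon> e *
            (\<Prod>(i, j, k)\<in>ancestral_triangles A e.
               bracket A s {i, k} / (bracket A s {i, k} + bracket A s {j, k}))))))"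
proof -
  define Z where "Z = {s \<in> (T - {{1, 2}}) \<rightarrow>\<^sub>E UNIV. \<forall>f\<in>{degeneracy A}. f s = 0}"
  have closed: "zariski_closed (T - {{1, 2}}) Z"
    unfolding zariski_closed_def Z_def using degeneracy_polynomial[OF assms(2)] by blast
  have "(\<lambda>e\<in>T - {{1, 2}}. 1) \<in> ((T - {{1, 2}}) \<rightarrow>\<^sub>E UNIV) - Z"
    using nondegenerate_ones[OF assms(2)] degeneracy_nonzero_iff[OF assms(2)] by (simp add: Z_def)
  moreover have "Z \<subseteq> (T - {{1, 2}}) \<rightarrow>\<^sub>E UNIV"
    unfolding Z_def by (rule Collect_restrict)
  ultimately have proper: "Z \<subset> (T - {{1, 2}}) \<rightarrow>\<^sub>E UNIV"
    by (metis Diff_iff psubsetI)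
  have "\<forall>e\<in>T. \<exists>\<sigma>. \<sigma> \<in> {1, -1} \<and> signed_product_formula A e \<sigma>"
    using signed_product_formula_exists[OF assms(2)] by blast
  then obtain \<epsilon> where \<epsilon>: "\<forall>e\<in>T. \<epsilon> e \<in> {1, -1} \<and> signed_product_formula A e (\<epsilon> e)"
    by (rule bchoice[THEN exE])
  have generic: "(\<exists>!x. critical_point n T s x) \<and>
      (\<forall>x. critical_point n T s x \<longrightarrow>
        (\<forall>e\<in>T. plucker e x = \<epsilon> e *
          (\<Prod>(i, j, k)\<in>ancestral_triangles A e.
             bracket A s {i, k} / (bracket A s {i, k} + bracket A s {j, k}))))"
    if "s \<in> ((T - {{1, 2}}) \<rightarrow>\<^sub>E UNIV) - Z" for s
  proof (intro conjI allI impI ballI)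
    have nd: "nondegenerate A (bracket A s)"
      using that degeneracy_nonzero_iff[OF assms(2)] by (simp add: Z_def)
    show "\<exists>!x. critical_point n T s x"
      by (rule critical_point_exists_unique[OF assms nd])
    fix x e
    assume "critical_point n T s x" and e: "e \<in> T"
    then have "triangle_relations A (bracket A s) (ycoord x)"
      using critical_point_iff_triangle_relations[OF assms nd] by blast
    then have "plucker e x = \<epsilon> e * (ycoord x 2 - ycoord x 1) *
        (\<Prod>(i, j, k)\<in>ancestral_triangles A e.
           bracket A s {i, k} / (bracket A s {i, k} + bracket A s {j, k}))"
      using \<epsilon> e nd unfolding signed_product_formula_def plucker_def by blast
    then show "plucker e x = \<epsilon> e *
        (\<Prod>(i, j, k)\<in>ancestral_triangles A e.
           bracket A s {i, k} / (bracket A s {i, k} + bracket A s {j, k}))"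
      by (simp add: ycoord_def)
  qed
  show ?thesis
    using closed proper \<epsilon> generic by (intro exI[of _ Z] conjI exI[of _ \<epsilon>]) auto
qed

end
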